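(* Let $N\ge 2$ and let $\lambda_1,\dots,\lambda_N$ (together with their complex conjugates) be the scaled eigenvalues of the quaternionic Ginibre ensemble, i.e. the eigenvalues of $\frac{1}{\sqrt{2N}}G$. Let $\mathbb{D}$ be the open unit disk and let $$\phi:\mathbb{C}^2\to\mathbb{D},\qquad \phi(z,w)=\frac{z}{\sqrt{1+|z|^2+|w|^2}}.$$ Conditionally on $(\lambda_1,\lambda_2)\in\mathbb{D}^2$ (i.e. given the values of $\lambda_1,\lambda_2$ in $\mathbb{D}$), the complex angles $\arg(\cdot,\cdot)$ between the right eigenvectors satisfy the following identities, where $X,Y$ are i.i.d. standard complex Gaussian variables (the same $X,Y$ in all identities): $$\arg(\lambda_1,\overline{\lambda_1})=\arg(\lambda_2,\overline{\lambda_2})=0,$$ $$\arg(\lambda_1,\lambda_2)=\phi\left(\frac{X}{\sqrt{2N}(\lambda_1-\lambda_2)},\frac{Y}{\sqrt{2N}(\overline{\lambda_1}-\lambda_2)}\right),\qquad \arg(\overline{\lambda_1},\overline{\lambda_2})=\overline{\arg(\lambda_1,\lambda_2)},$$ $$\arg(\overline{\lambda_1},\lambda_2)=\phi\left(\frac{-\overline{Y}}{\sqrt{2N}(\overline{\lambda_1}-\lambda_2)},\frac{X}{\sqrt{2N}(\lambda_1-\lambda_2)}\right),\qquad \arg(\lambda_1,\overline{\lambda_2})=-\overline{\arg(\overline{\lambda_1},\lambda_2)}.$$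
   Context: $\mu$ denotes the standard complex Gaussian measure $d\mu(z)=\frac1\pi e^{-|z|^2}dm(z)$ on $\mathbb{C}$. The unscaled quaternionic Ginibre matrix $G$ is the $2N\times 2N$ complex matrix made of $N^2$ independent $2\times2$ blocks $\begin{pmatrix} z&-\overline w\\ w&\overline z\end{pmatrix}$ with $z,w$ i.i.d. standard complex Gaussian. Its eigenvalues form $N$ complex conjugate pairs, and the representatives $(\lambda_1,\dots,\lambda_N)$ of these pairs are labelled so that, before scaling, their joint law is proportional to $\prod_{i<j}|\lambda_i-\lambda_j|^2\prod_{i\le j}|\lambda_i-\overline{\lambda_j}|^2\,d\mu^N(\lambda_1,\dots,\lambda_N)$; the scaled eigenvalues are these divided by $\sqrt{2N}$. Schur form (known fact): $G$ is unitarily equivalent to a block upper-triangular matrix with $2\times 2$ diagonal blocks $\mathrm{diag}(\lambda_i,\overline{\lambda_i})$ ($\lambda_i$ the unscaled eigenvalues) and upper-diagonal blocks $T_{i,j}=\begin{pmatrix}u_{i,j}&v_{i,j}\\-\overline{v_{i,j}}&\overline{u_{i,j}}\end{pmatrix}$, $i<j$, where all $u_{i,j},v_{i,j}$ are i.i.d. standard complex Gaussian variables, independent of the diagonal blocks. The scaled matrix $\frac1{\sqrt{2N}}G$ has the Schur form divided by $\sqrt{2N}$. Statistics of eigenvectors are computed on the Schur form. Almost surely all eigenvalues are distinct. Let $R_1,\widetilde R_1,R_2,\widetilde R_2\in\mathbb{C}^{2N}$ be the right eigenvectors of the Schur form associated to $\lambda_1,\overline{\lambda_1},\lambda_2,\overline{\lambda_2}$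 respectively, normalized as column vectors by $R_1=(1,0,\dots,0)$, $\widetilde R_1=(0,1,0,\dots,0)$, $R_2=(\ast,\ast,1,0,0,\dots,0)$, $\widetilde R_2=(\ast,\ast,0,1,0,\dots,0)$, the starred entries being determined by the eigenvector equation. The complex angle between the right eigenvectors $R,R'$ associated to eigenvalues $\lambda,\lambda'$ is $$\arg(\lambda,\lambda')=\frac{\langle R|R'\rangle}{\|R\|\,\|R'\|},\qquad \langle \mathbf{u}|\mathbf{v}\rangle=\sum_k\overline{u_k}v_k.$$ *)

theory Defs
  imports
    "HOL-Probability.Probability"
    "Jordan_Normal_Form.Char_Poly"
    "Jordan_Normal_Form.Schur_Decomposition"
begin

no_notation vec_nth (infixl "$" 90)

definition std_complex_gaussian :: "complex measure" where
  "std_complex_gaussian = density lborel (\<lambda>z. ennreal (exp (- (cmod z)\<^sup>2) / pi))"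

definition iid_std_complex_gaussian ::
    "'a measure \<Rightarrow> 'i set \<Rightarrow> ('i \<Rightarrow> 'a \<Rightarrow> complex) \<Rightarrow> bool" where
  "iid_std_complex_gaussian M I Z \<longleftrightarrow>
     prob_space.indep_vars M (\<lambda>_. borel) Z I \<and>
     (\<forall>i\<in>I. distr M borel (Z i) = std_complex_gaussian)"

(* The library's indep_var, except that the two variables may take values in different types. *)
definition independent_variables ::
    "'a measure \<Rightarrow> 'b measure \<Rightarrow> ('a \<Rightarrow> 'b) \<Rightarrow> 'c measure \<Rightarrow> ('a \<Rightarrow> 'c) \<Rightarrow> bool" where
  "independent_variables M A X B Y \<longleftrightarrow>
     X \<in> measurable M A \<and> Y \<in> measurable M B \<and>
     prob_space.indep_set M
       {X -` S \<inter> space M | S. S \<in> sets A} {Y -` S \<inter> space M | S. S \<in> sets B}"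

(* All indices are 0-based: the first index of the mathematical text is 0 here. *)

definition block_matrix :: "nat \<Rightarrow> (nat \<Rightarrow> nat \<Rightarrow> complex mat) \<Rightarrow> complex mat" where
  "block_matrix N B =
     mat (2 * N) (2 * N) (\<lambda>(r, c). B (r div 2) (c div 2) $$ (r mod 2, c mod 2))"

definition quaternionic_matrix ::
    "nat \<Rightarrow> (nat \<Rightarrow> nat \<Rightarrow> complex) \<Rightarrow> (nat \<Rightarrow> nat \<Rightarrow> complex) \<Rightarrow> complex mat" where
  "quaternionic_matrix N z w =
     block_matrix N (\<lambda>i j. mat_of_rows_list 2
       [[z i j, - cnj (w i j)],
        [w i j, cnj (z i j)]])"

definition schur_matrix ::
    "nat \<Rightarrow> (nat \<Rightarrow> complex) \<Rightarrow> (nat \<Rightarrow> nat \<Rightarrow> complex) \<Rightarrow> (nat \<Rightarrow> nat \<Rightarrow> complex) \<Rightarrow> complex mat" where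
  "schur_matrix N lam u v =
     block_matrix N (\<lambda>i j.
       if i = j then mat_of_rows_list 2
         [[lam i, 0],
          [0, cnj (lam i)]]
       else if i < j then mat_of_rows_list 2
         [[u i j, v i j],
          [- cnj (v i j), cnj (u i j)]]
       else 0\<^sub>m 2 2)"

definition unitarily_equivalent :: "nat \<Rightarrow> complex mat \<Rightarrow> complex mat \<Rightarrow> bool" where
  "unitarily_equivalent n A B \<longleftrightarrow>
     (\<exists>U \<in> carrier_mat n n. U * mat_adjoint U = 1\<^sub>m n \<and> mat_adjoint U * U = 1\<^sub>m n \<and>
        A = U * B * mat_adjoint U)"

definition upper_pairs :: "nat \<Rightarrow> (nat \<times> nat) set" where
  "upper_pairs N = {(i, j). i < j \<and> j < N}"

(* Two families of variables indexed by pairs, merged into a single family. *)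
definition joint_family ::
    "(nat \<Rightarrow> nat \<Rightarrow> 'a \<Rightarrow> complex) \<Rightarrow> (nat \<Rightarrow> nat \<Rightarrow> 'a \<Rightarrow> complex) \<Rightarrow>
     (nat \<times> nat) + (nat \<times> nat) \<Rightarrow> 'a \<Rightarrow> complex" where
  "joint_family f g = case_sum (\<lambda>(i, j). f i j) (\<lambda>(i, j). g i j)"

definition random_vector :: "'i set \<Rightarrow> ('i \<Rightarrow> 'a \<Rightarrow> complex) \<Rightarrow> 'a \<Rightarrow> 'i \<Rightarrow> complex" where
  "random_vector I Z \<omega> = (\<lambda>i\<in>I. Z i \<omega>)"

definition eigenvalue_weight :: "nat \<Rightarrow> (nat \<Rightarrow> complex) \<Rightarrow> real" where
  "eigenvalue_weight N x =
     (\<Prod>j<N. \<Prod>i<j. (cmod (x i - x j))\<^sup>2) * (\<Prod>j<N. \<Prod>i\<le>j. (cmod (x i - cnj (x j)))\<^sup>2)"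

definition has_ginibre_eigenvalue_law ::
    "'a measure \<Rightarrow> nat \<Rightarrow> (nat \<Rightarrow> 'a \<Rightarrow> complex) \<Rightarrow> bool" where
  "has_ginibre_eigenvalue_law M N lam \<longleftrightarrow>
     (\<forall>i<N. lam i \<in> borel_measurable M) \<and>
     (\<exists>c>0. distr M (PiM {..<N} (\<lambda>_. borel)) (random_vector {..<N} lam) =
        density (PiM {..<N} (\<lambda>_. std_complex_gaussian))
          (\<lambda>x. ennreal (c * eigenvalue_weight N x)))"

(* Entry k is 1 and all other entries from the start of the 2-block of k onwards vanish; for
   k = 0, 1, 2, 3 this gives (1,0,...), (0,1,0,...), ( *,*,1,0,0,...), ( *,*,0,1,0,...). *)
definition normalized_right_eigenvector ::
    "complex mat \<Rightarrow> complex \<Rightarrow> nat \<Rightarrow> complex vec \<Rightarrow> bool" where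
  "normalized_right_eigenvector A \<mu> k R \<longleftrightarrow>
     eigenvector A R \<mu> \<and>
     (\<forall>i < dim_row A. 2 * (k div 2) \<le> i \<longrightarrow> R $ i = (if i = k then 1 else 0))"

definition hermitian_product :: "complex vec \<Rightarrow> complex vec \<Rightarrow> complex" where
  "hermitian_product x y = (\<Sum>k<dim_vec x. cnj (x $ k) * y $ k)"

definition hermitian_norm :: "complex vec \<Rightarrow> real" where
  "hermitian_norm x = sqrt (\<Sum>k<dim_vec x. (cmod (x $ k))\<^sup>2)"

definition complex_angle :: "complex vec \<Rightarrow> complex vec \<Rightarrow> complex" where
  "complex_angle x y =
     hermitian_product x y / complex_of_real (hermitian_norm x * hermitian_norm y)"

definition phi :: "complex \<Rightarrow> complex \<Rightarrow> complex" where
  "phi z w = z / complex_of_real (sqrt (1 + (cmod z)\<^sup>2 + (cmod w)\<^sup>2))"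

lemma phi_in_unit_disc: "phi z w \<in> ball 0 1"
proof -
  have "cmod z < sqrt (1 + (cmod z)\<^sup>2 + (cmod w)\<^sup>2)"
    by (rule real_less_rsqrt) (simp add: add_pos_nonneg)
  moreover have "0 < sqrt (1 + (cmod z)\<^sup>2 + (cmod w)\<^sup>2)"
    by (simp add: add_pos_nonneg)
  ultimately show ?thesis
    by (simp add: phi_def norm_divide)
qed

end

theory Submission
  imports Defs
begin

text \<open>
  Write \<open>u\<close>, \<open>v\<close> for the entries of the Schur block \<open>T\<^sub>1\<^sub>2\<close>. Since the Schur form is block upper
  triangular, the eigenvector equation for \<open>\<lambda>\<^sub>2\<close> or its conjugate only involves the first two
  blocks: its first two rows determine the two starred entries, each by a linear equation whose
  coefficient is a difference of eigenvalues. Solving them gives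
  \<open>R\<^sub>2 = (p, q, 1, 0, \<dots>)\<close> with \<open>p = - u / (s (\<lambda>\<^sub>1 - \<lambda>\<^sub>2))\<close> and
  \<open>q = cnj v / (s (cnj \<lambda>\<^sub>1 - \<lambda>\<^sub>2))\<close>, where \<open>s\<close> is the scaling factor, and the quaternionic
  symmetry of the matrix turns this into \<open>R\<^sub>2' = (- cnj q, cnj p, 0, 1, \<dots>)\<close>
  (lemma \<open>schur_second_eigenvectors\<close>). The eigenvectors for \<open>\<lambda>\<^sub>1\<close> and its conjugate are the
  first two basis vectors, so all angles can be read off from \<open>p\<close> and \<open>q\<close>
  (lemma \<open>complex_angles_conjugate_frame\<close>): up to sign and conjugation they are
  \<open>phi p q\<close>, \<open>phi q p\<close> and \<open>0\<close>.

  The variables to exhibit are therefore \<open>X = - u\<close> and \<open>Y = - v\<close>. The numerator of \<open>p\<close> is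
  \<open>X\<close> and that of \<open>q\<close> is \<open>- cnj Y\<close>, as required by the formula for the angle of
  \<open>cnj \<lambda>\<^sub>1\<close> and \<open>\<lambda>\<^sub>2\<close>; in the formula for the angle of \<open>\<lambda>\<^sub>1\<close> and \<open>\<lambda>\<^sub>2\<close>
  the second argument of \<open>phi\<close> is \<open>Y\<close> over the same denominator, which makes no difference because
  \<open>phi\<close> sees this argument only through its modulus.

  The probabilistic content is light. The standard complex Gaussian is invariant under negation, so
  \<open>X\<close> and \<open>Y\<close> are again independent standard Gaussians, and they are independent of the
  eigenvalues because the whole upper triangular part is. The divisions are legitimate almost surely
  since the density of the eigenvalues vanishes where \<open>\<lambda>\<^sub>1 = \<lambda>\<^sub>2\<close> or \<open>\<lambda>\<^sub>1 = cnj \<lambda>\<^sub>2\<close>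
  (lemma \<open>ginibre_eigenvalues_distinct\<close>).
\<close>

section \<open>Gaussian symmetry and independence\<close>

lemma lborel_distr_uminus_euclidean:
  "distr lborel borel uminus = (lborel :: 'a :: euclidean_space measure)"
  by (subst lborel_affine[of "-1" 0]) (auto simp: density_1 one_ennreal_def[symmetric])

text \<open>
  Both Lebesgue measure and the density, a function of the modulus, are invariant under negation.
\<close>
lemma std_complex_gaussian_uminus:
  "distr std_complex_gaussian borel uminus = std_complex_gaussian"
proof -
  have "std_complex_gaussian =
      density (distr lborel borel uminus) (\<lambda>z. ennreal (exp (- (cmod z)\<^sup>2) / pi))"
    by (simp add: std_complex_gaussian_def lborel_distr_uminus_euclidean)
  also have "\<dots> = distr std_complex_gaussian borel uminus"
    by (subst density_distr) (simp_all add: std_complex_gaussian_def)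
  finally show ?thesis by simp
qed

lemma distr_uminus_std_complex_gaussian:
  assumes "distr M borel Z = std_complex_gaussian" and [measurable]: "Z \<in> borel_measurable M"
  shows "distr M borel (\<lambda>\<omega>. - Z \<omega>) = std_complex_gaussian"
proof -
  have "distr M borel (\<lambda>\<omega>. - Z \<omega>) = distr (distr M borel Z) borel uminus"
    by (subst distr_distr) (simp_all add: comp_def)
  then show ?thesis by (simp add: assms std_complex_gaussian_uminus)
qed

lemma (in prob_space) indep_vars_pair:
  assumes "indep_vars (\<lambda>_. N) Z I" and "i \<in> I" "j \<in> I" "i \<noteq> j"
  shows "indep_var N (Z i) N (Z j)"
proof -
  have "indep_var N ((\<lambda>f. f i) \<circ> (\<lambda>\<omega>. restrict (\<lambda>k. Z k \<omega>) {i}))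
      N ((\<lambda>f. f j) \<circ> (\<lambda>\<omega>. restrict (\<lambda>k. Z k \<omega>) {j}))"
    by (rule indep_var_compose[OF indep_var_restrict[OF assms(1)]])
       (use assms in \<open>auto intro: measurable_component_singleton\<close>)
  then show ?thesis by (simp add: comp_def)
qed

text \<open>
  The events generated by a function of a random vector are among those generated by the vector, and
  they are closed under intersection, so the product rule for them passes to the generated
  \<open>\<sigma>\<close>-algebras. The values of \<open>X\<close> and \<open>Y\<close> may have different types, here families over different
  index sets; \<open>f\<close> and \<open>g\<close> bring them into a common type.
\<close>
lemma (in prob_space) independent_variables_compose:
  fixes S :: "'s measure"
  assumes "independent_variables M A X B Y"
    and f: "f \<in> measurable A S" and g: "g \<in> measurable B S"
  shows "indep_var S (\<lambda>\<omega>. g (Y \<omega>)) S (\<lambda>\<omega>. f (X \<omega>))"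
proof -
  have X: "X \<in> measurable M A" and Y: "Y \<in> measurable M B"
    and ind: "indep_set {X -` S \<inter> space M | S. S \<in> sets A} {Y -` S \<inter> space M | S. S \<in> sets B}"
    using assms(1) by (auto simp: independent_variables_def)
  have fX: "(\<lambda>\<omega>. f (X \<omega>)) \<in> measurable M S" and gY: "(\<lambda>\<omega>. g (Y \<omega>)) \<in> measurable M S"
    using X Y f g by (auto intro: measurable_compose)
  have pull_back: "{(\<lambda>\<omega>. h (Z \<omega>)) -` U \<inter> space M | U. U \<in> sets S}
      \<subseteq> {Z -` C \<inter> space M | C. C \<in> sets D}"
    if Z: "Z \<in> measurable M D" and h: "h \<in> measurable D S" for Z h and D :: "'z measure"
  proof safe
    fix U assume "U \<in> sets S"
    with h have "h -` U \<inter> space D \<in> sets D"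
      by (rule measurable_sets)
    moreover have "(\<lambda>\<omega>. h (Z \<omega>)) -` U \<inter> space M = Z -` (h -` U \<inter> space D) \<inter> space M"
      using measurable_space[OF Z] by auto
    ultimately show "\<exists>C. (\<lambda>\<omega>. h (Z \<omega>)) -` U \<inter> space M = Z -` C \<inter> space M \<and> C \<in> sets D"
      by blast
  qed
  have Int_stable_preimages: "Int_stable {Z -` U \<inter> space M | U. U \<in> sets S}" for Z :: "'a \<Rightarrow> 's"
  proof (rule Int_stableI, safe)
    fix U V assume "U \<in> sets S" "V \<in> sets S"
    then show "\<exists>W. Z -` U \<inter> space M \<inter> (Z -` V \<inter> space M) = Z -` W \<inter> space M \<and> W \<in> sets S"
      by (intro exI[of _ "U \<inter> V"]) auto
  qed
  have "indep_set {(\<lambda>\<omega>. g (Y \<omega>)) -` U \<inter> space M | U. U \<in> sets S}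
      {(\<lambda>\<omega>. f (X \<omega>)) -` U \<inter> space M | U. U \<in> sets S}"
    unfolding indep_sets2_eq
  proof (intro conjI ballI)
    fix a b
    assume "a \<in> {(\<lambda>\<omega>. g (Y \<omega>)) -` U \<inter> space M | U. U \<in> sets S}"
      and "b \<in> {(\<lambda>\<omega>. f (X \<omega>)) -` U \<inter> space M | U. U \<in> sets S}"
    then have "a \<in> {Y -` S \<inter> space M | S. S \<in> sets B}" "b \<in> {X -` S \<inter> space M | S. S \<in> sets A}"
      using subsetD[OF pull_back[OF Y g]] subsetD[OF pull_back[OF X f]] by simp_all
    from indep_setD[OF ind this(2) this(1)] show "prob (a \<inter> b) = prob a * prob b"
      by (simp add: Int_commute mult.commute)
  qed (use fX gY in \<open>auto intro: measurable_sets\<close>)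
  then have "indep_set (sigma_sets (space M) {(\<lambda>\<omega>. g (Y \<omega>)) -` U \<inter> space M | U. U \<in> sets S})
      (sigma_sets (space M) {(\<lambda>\<omega>. f (X \<omega>)) -` U \<inter> space M | U. U \<in> sets S})"
    by (rule indep_set_sigma_sets) (rule Int_stable_preimages)+
  with fX gY show ?thesis by (simp add: indep_var_eq)
qed

section \<open>Almost sure separation of the eigenvalues\<close>

lemma eigenvalue_weight_nonzeroD:
  assumes "eigenvalue_weight N x \<noteq> 0" "i < j" "j < N"
  shows "x i \<noteq> x j" "x i \<noteq> cnj (x j)"
  using assms by (auto simp: eigenvalue_weight_def)

lemma borel_measurable_eigenvalue_weight:
  "eigenvalue_weight N \<in> borel_measurable (PiM {..<N} (\<lambda>_. std_complex_gaussian))"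
proof -
  have "sets std_complex_gaussian = sets borel"
    by (simp add: std_complex_gaussian_def)
  then have coord: "(\<lambda>x. x i) \<in> borel_measurable (PiM {..<N} (\<lambda>_. std_complex_gaussian))" if "i < N" for i
    using measurable_component_singleton[of i "{..<N}" "\<lambda>_. std_complex_gaussian"] that
    by (simp cong: measurable_cong_sets)
  have coord_cnj: "(\<lambda>x. cnj (x i)) \<in> borel_measurable (PiM {..<N} (\<lambda>_. std_complex_gaussian))"
    if "i < N" for i
    by (rule measurable_compose[OF coord[OF that]])
       (intro borel_measurable_continuous_onI continuous_intros)
  have dist: "(\<lambda>x. cmod (x i - x j)) \<in> borel_measurable (PiM {..<N} (\<lambda>_. std_complex_gaussian))"
      "(\<lambda>x. cmod (x i - cnj (x j))) \<in> borel_measurable (PiM {..<N} (\<lambda>_. std_complex_gaussian))"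
    if "i < N" "j < N" for i j
    using that coord coord_cnj by measurable
  show ?thesis
    unfolding eigenvalue_weight_def[abs_def]
    by (intro borel_measurable_times borel_measurable_prod borel_measurable_power dist) auto
qed

text \<open>
  A set on which a density vanishes is a null set, so it is enough that the weight has a factor for
  each of the two excluded coincidences.
\<close>
lemma ginibre_eigenvalues_distinct:
  assumes law: "has_ginibre_eigenvalue_law M N lam" and "i < j" "j < N"
  shows "AE \<omega> in M. lam i \<omega> \<noteq> lam j \<omega> \<and> lam i \<omega> \<noteq> cnj (lam j \<omega>)"
proof -
  let ?P = "PiM {..<N} (\<lambda>_. borel) :: (nat \<Rightarrow> complex) measure"
  from law obtain c :: real where lam: "\<And>i. i < N \<Longrightarrow> lam i \<in> borel_measurable M"
    and distr: "distr M ?P (random_vector {..<N} lam) =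
        density (PiM {..<N} (\<lambda>_. std_complex_gaussian)) (\<lambda>x. ennreal (c * eigenvalue_weight N x))"
    unfolding has_ginibre_eigenvalue_law_def by blast
  have vec: "random_vector {..<N} lam \<in> measurable M ?P"
    unfolding random_vector_def[abs_def] by (rule measurable_restrict) (simp add: lam)
  have [measurable]: "eigenvalue_weight N \<in> borel_measurable (PiM {..<N} (\<lambda>_. std_complex_gaussian))"
    by (rule borel_measurable_eigenvalue_weight)
  have "AE x in distr M ?P (random_vector {..<N} lam). x i \<noteq> x j \<and> x i \<noteq> cnj (x j)"
    unfolding distr
  proof (subst AE_density, measurable, rule AE_I2, intro impI)
    fix x assume "0 < ennreal (c * eigenvalue_weight N x)"
    then have "eigenvalue_weight N x \<noteq> 0" by auto
    with assms show "x i \<noteq> x j \<and> x i \<noteq> cnj (x j)"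
      by (auto dest: eigenvalue_weight_nonzeroD)
  qed
  from AE_distrD[OF vec this] show ?thesis
    using assms(2,3) by (simp add: random_vector_def)
qed

section \<open>Eigenvectors of the Schur form\<close>

lemma schur_matrix_carrier: "schur_matrix N lam u v \<in> carrier_mat (2 * N) (2 * N)"
  by (simp add: schur_matrix_def block_matrix_def)

lemma schur_matrix_first_rows:
  fixes lam :: "nat \<Rightarrow> complex" and u v :: "nat \<Rightarrow> nat \<Rightarrow> complex"
  assumes "N \<ge> 2"
  defines "T \<equiv> schur_matrix N lam u v"
  shows "T $$ (0, 0) = lam 0" "T $$ (0, 1) = 0" "T $$ (0, 2) = u 0 1" "T $$ (0, 3) = v 0 1"
    and "T $$ (1, 0) = 0" "T $$ (1, 1) = cnj (lam 0)"
      "T $$ (1, 2) = - cnj (v 0 1)" "T $$ (1, 3) = cnj (u 0 1)"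
  using assms by (simp_all add: T_def schur_matrix_def block_matrix_def mat_of_rows_list_def)

text \<open>
  The normalization fixes all entries from the block of \<open>k\<close> on, so that row \<open>i\<close> of the eigenvector
  equation is a finite linear equation in the entries of the earlier blocks.
\<close>
lemma normalized_right_eigenvector_row:
  assumes A: "A \<in> carrier_mat n n" and R: "normalized_right_eigenvector A \<mu> k R"
    and "i < n" "k < n"
  shows "(\<Sum>j<2 * (k div 2). A $$ (i, j) * R $ j) + A $$ (i, k) = \<mu> * R $ i"
proof -
  have dim: "R \<in> carrier_vec n" and ev: "A *\<^sub>v R = \<mu> \<cdot>\<^sub>v R"
    and tail: "\<And>j. j < n \<Longrightarrow> 2 * (k div 2) \<le> j \<Longrightarrow> R $ j = (if j = k then 1 else 0)"
    using A R by (auto simp: normalized_right_eigenvector_def eigenvector_def)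
  have "\<mu> * R $ i = (A *\<^sub>v R) $ i"
    using ev dim \<open>i < n\<close> by simp
  also have "\<dots> = (\<Sum>j\<in>{..<n}. A $$ (i, j) * R $ j)"
    using A dim \<open>i < n\<close> by (simp add: scalar_prod_def atLeast0LessThan)
  also have "{..<n} = {..<2 * (k div 2)} \<union> {2 * (k div 2)..<n}"
    using \<open>k < n\<close> by auto
  also have "(\<Sum>j\<in>\<dots>. A $$ (i, j) * R $ j) = (\<Sum>j<2 * (k div 2). A $$ (i, j) * R $ j)
      + (\<Sum>j\<in>{2 * (k div 2)..<n}. A $$ (i, j) * R $ j)"
    by (rule sum.union_disjoint) auto
  also have "(\<Sum>j\<in>{2 * (k div 2)..<n}. A $$ (i, j) * R $ j)
      = (\<Sum>j\<in>{2 * (k div 2)..<n}. if j = k then A $$ (i, j) else 0)"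
    by (rule sum.cong) (auto simp: tail)
  also have "\<dots> = A $$ (i, k)"
    using \<open>k < n\<close> by simp
  finally show ?thesis by simp
qed

text \<open>
  All four eigenvectors are supported on the first two blocks, hence have this shape.
\<close>
definition two_block_vec ::
    "nat \<Rightarrow> complex \<Rightarrow> complex \<Rightarrow> complex \<Rightarrow> complex \<Rightarrow> complex vec" where
  "two_block_vec n a b c d = vec n (\<lambda>i. if i < 4 then [a, b, c, d] ! i else 0)"

lemma normalized_right_eigenvector_two_block:
  assumes "A \<in> carrier_mat n n" "n \<ge> 4" "normalized_right_eigenvector A \<mu> k R"
  shows "k = 0 \<Longrightarrow> R = two_block_vec n 1 0 0 0"
    and "k = 1 \<Longrightarrow> R = two_block_vec n 0 1 0 0"
    and "k = 2 \<Longrightarrow> R = two_block_vec n (R $ 0) (R $ 1) 1 0"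
    and "k = 3 \<Longrightarrow> R = two_block_vec n (R $ 0) (R $ 1) 0 1"
proof -
  have dim: "dim_vec R = n"
    and tail: "\<And>i. i < n \<Longrightarrow> 2 * (k div 2) \<le> i \<Longrightarrow> R $ i = (if i = k then 1 else 0)"
    using assms by (auto simp: normalized_right_eigenvector_def eigenvector_def)
  have less_4_cases: "i < 4 \<longleftrightarrow> i = 0 \<or> i = 1 \<or> i = 2 \<or> i = 3" for i :: nat
    by linarith
  have eqI: "R = two_block_vec n a b c d"
    if "\<And>i. i < n \<Longrightarrow> i < 4 \<Longrightarrow> R $ i = [a, b, c, d] ! i" "k < 4" for a b c d
  proof (rule eq_vecI)
    fix i assume "i < dim_vec (two_block_vec n a b c d)"
    then have "i < n" by (simp add: two_block_vec_def)
    moreover have "2 * (k div 2) \<le> i" if "4 \<le> i"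
      using that \<open>k < 4\<close> by presburger
    ultimately show "R $ i = two_block_vec n a b c d $ i"
      using that(1)[of i] tail[of i] \<open>k < 4\<close> by (simp add: two_block_vec_def)
  qed (simp add: dim two_block_vec_def)
  show "R = two_block_vec n 1 0 0 0" if "k = 0"
    by (rule eqI) (use tail that in \<open>auto simp: less_4_cases\<close>)
  show "R = two_block_vec n 0 1 0 0" if "k = 1"
    by (rule eqI) (use tail that in \<open>auto simp: less_4_cases\<close>)
  show "R = two_block_vec n (R $ 0) (R $ 1) 1 0" if "k = 2"
    by (rule eqI) (use tail that in \<open>auto simp: less_4_cases\<close>)
  show "R = two_block_vec n (R $ 0) (R $ 1) 0 1" if "k = 3"
    by (rule eqI) (use tail that in \<open>auto simp: less_4_cases\<close>)
qed

text \<open>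
  Rows 0 and 1 of the eigenvector equation decouple because the diagonal block of \<open>\<lambda>\<^sub>1\<close> is
  diagonal. The entries of \<open>R'\<close> come from those of \<open>R\<close> by the antilinear map
  \<open>(a, b) \<mapsto> (- cnj b, cnj a)\<close> on each block, which commutes with every quaternionic block
  and therefore maps eigenvectors for \<open>\<mu>\<close> to eigenvectors for \<open>cnj \<mu>\<close>; the proof verifies
  this by solving the equations for \<open>R'\<close> directly.
\<close>
lemma schur_second_eigenvectors:
  fixes s :: real and lam l :: "nat \<Rightarrow> complex" and u v :: "nat \<Rightarrow> nat \<Rightarrow> complex"
  assumes "N \<ge> 2" "s \<noteq> 0"
    and distinct: "lam 0 \<noteq> lam 1" "lam 0 \<noteq> cnj (lam 1)"
  defines "T \<equiv> (1 / complex_of_real s) \<cdot>\<^sub>m schur_matrix N lam u v"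
    and "l \<equiv> \<lambda>i. lam i / complex_of_real s"
  defines "p \<equiv> - u 0 1 / (s * (l 0 - l 1))" and "q \<equiv> cnj (v 0 1) / (s * (cnj (l 0) - l 1))"
  shows "normalized_right_eigenvector T (l 1) 2 R \<Longrightarrow> R = two_block_vec (2 * N) p q 1 0"
    and "normalized_right_eigenvector T (cnj (l 1)) 3 R' \<Longrightarrow>
      R' = two_block_vec (2 * N) (- cnj q) (cnj p) 0 1"
proof -
  let ?s = "complex_of_real s"
  have T: "T \<in> carrier_mat (2 * N) (2 * N)"
    using schur_matrix_carrier by (simp add: T_def)
  have entry: "T $$ (i, j) = schur_matrix N lam u v $$ (i, j) / ?s" if "i < 4" "j < 4" for i j
    using that \<open>N \<ge> 2\<close> schur_matrix_carrier[of N lam u v] by (simp add: T_def)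
  note entries = entry schur_matrix_first_rows[OF \<open>N \<ge> 2\<close>, of lam u v]
  have "cnj (lam 0) \<noteq> lam 1"
    using distinct(2) by (metis complex_cnj_cnj)
  then have gap: "?s * (l 0 - l 1) = lam 0 - lam 1" "?s * (cnj (l 0) - l 1) = cnj (lam 0) - lam 1"
    and nz: "lam 0 - lam 1 \<noteq> 0" "cnj (lam 0) - lam 1 \<noteq> 0"
      "cnj (lam 0) - cnj (lam 1) \<noteq> 0" "lam 0 - cnj (lam 1) \<noteq> 0"
    using \<open>s \<noteq> 0\<close> distinct by (auto simp: l_def right_diff_distrib)
  have pq: "p = - u 0 1 / (lam 0 - lam 1)" "q = cnj (v 0 1) / (cnj (lam 0) - lam 1)"
    by (simp_all only: p_def q_def gap)
  show "R = two_block_vec (2 * N) p q 1 0" if "normalized_right_eigenvector T (l 1) 2 R"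
  proof -
    have row: "(\<Sum>j<2. T $$ (i, j) * R $ j) + T $$ (i, 2) = l 1 * R $ i" if "i < 2" for i
      using normalized_right_eigenvector_row[OF T \<open>normalized_right_eigenvector T (l 1) 2 R\<close>, of i]
        that \<open>N \<ge> 2\<close> by simp
    have "lam 0 * R $ 0 + u 0 1 = lam 1 * R $ 0"
      using row[of 0] entries \<open>s \<noteq> 0\<close> by (simp add: l_def numeral_2_eq_2 field_simps)
    moreover have "cnj (lam 0) * R $ 1 - cnj (v 0 1) = lam 1 * R $ 1"
      using row[of 1] entries \<open>s \<noteq> 0\<close> by (simp add: l_def numeral_2_eq_2 field_simps)
    ultimately have "(lam 0 - lam 1) * R $ 0 = - u 0 1"
        "(cnj (lam 0) - lam 1) * R $ 1 = cnj (v 0 1)"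
      by (simp_all add: algebra_simps)
    then have "R $ 0 = p" "R $ 1 = q"
      using nz by (simp_all only: pq eq_divide_eq mult.commute not_False_eq_True if_True)
    then show ?thesis
      using normalized_right_eigenvector_two_block(3)[OF T _ that] \<open>N \<ge> 2\<close> by simp
  qed
  show "R' = two_block_vec (2 * N) (- cnj q) (cnj p) 0 1"
    if "normalized_right_eigenvector T (cnj (l 1)) 3 R'"
  proof -
    have row: "(\<Sum>j<2. T $$ (i, j) * R' $ j) + T $$ (i, 3) = cnj (l 1) * R' $ i" if "i < 2" for i
      using normalized_right_eigenvector_row[OF T
          \<open>normalized_right_eigenvector T (cnj (l 1)) 3 R'\<close>, of i] that \<open>N \<ge> 2\<close> by simp
    have "lam 0 * R' $ 0 + v 0 1 = cnj (lam 1) * R' $ 0"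
      using row[of 0] entries \<open>s \<noteq> 0\<close> by (simp add: l_def numeral_2_eq_2 field_simps)
    moreover have "cnj (lam 0) * R' $ 1 + cnj (u 0 1) = cnj (lam 1) * R' $ 1"
      using row[of 1] entries \<open>s \<noteq> 0\<close> by (simp add: l_def numeral_2_eq_2 field_simps)
    ultimately have "(lam 0 - cnj (lam 1)) * R' $ 0 = - v 0 1"
        "(cnj (lam 0) - cnj (lam 1)) * R' $ 1 = - cnj (u 0 1)"
      by (simp_all add: algebra_simps)
    then have "R' $ 0 = - v 0 1 / (lam 0 - cnj (lam 1))"
        "R' $ 1 = - cnj (u 0 1) / (cnj (lam 0) - cnj (lam 1))"
      using nz by (simp_all only: eq_divide_eq mult.commute not_False_eq_True if_True)
    then have "R' $ 0 = - cnj q" "R' $ 1 = cnj p"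
      by (simp_all only: pq complex_cnj_divide complex_cnj_diff complex_cnj_cnj
          complex_cnj_minus minus_divide_left)
    then show ?thesis
      using normalized_right_eigenvector_two_block(4)[OF T _ that] \<open>N \<ge> 2\<close> by simp
  qed
qed

section \<open>The angles between eigenvectors\<close>

lemma sum_first_four:
  fixes f :: "nat \<Rightarrow> 'a :: comm_monoid_add"
  assumes "n \<ge> 4" "\<And>i. 4 \<le> i \<Longrightarrow> i < n \<Longrightarrow> f i = 0"
  shows "(\<Sum>i<n. f i) = f 0 + f 1 + f 2 + f 3"
proof -
  have "(\<Sum>i<n. f i) = (\<Sum>i<4. f i)"
    using assms by (intro sum.mono_neutral_right) auto
  then show ?thesis by (simp add: numeral_eq_Suc)
qed

lemma complex_angle_two_block:
  assumes "n \<ge> 4"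
  shows "complex_angle (two_block_vec n a b c d) (two_block_vec n a' b' c' d') =
    (cnj a * a' + cnj b * b' + cnj c * c' + cnj d * d') / complex_of_real
      (sqrt ((cmod a)\<^sup>2 + (cmod b)\<^sup>2 + (cmod c)\<^sup>2 + (cmod d)\<^sup>2) *
       sqrt ((cmod a')\<^sup>2 + (cmod b')\<^sup>2 + (cmod c')\<^sup>2 + (cmod d')\<^sup>2))"
  using assms
  by (simp add: complex_angle_def hermitian_product_def hermitian_norm_def two_block_vec_def
      sum_first_four)

text \<open>
  \<open>R\<close> and \<open>R'\<close> are orthogonal and have the same norm \<open>sqrt (1 + |p|\<^sup>2 + |q|\<^sup>2)\<close>, which is
  the denominator in \<open>phi p q\<close> and in \<open>phi q p\<close>.
\<close>
lemma complex_angles_conjugate_frame: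
  fixes p q :: complex
  assumes "n \<ge> 4"
  defines "E0 \<equiv> two_block_vec n 1 0 0 0" and "E1 \<equiv> two_block_vec n 0 1 0 0"
    and "R \<equiv> two_block_vec n p q 1 0" and "R' \<equiv> two_block_vec n (- cnj q) (cnj p) 0 1"
  shows "complex_angle E0 E1 = 0" "complex_angle R R' = 0"
    and "complex_angle E0 R = phi p q" "complex_angle E1 R = phi q p"
    and "complex_angle E1 R' = cnj (complex_angle E0 R)"
    and "complex_angle E0 R' = - cnj (complex_angle E1 R)"
  unfolding E0_def E1_def R_def R'_def complex_angle_two_block[OF assms(1)]
  by (simp_all add: phi_def add_ac)

lemma phi_cong_cmod: "cmod w = cmod w' \<Longrightarrow> phi z w = phi z w'"
  by (simp add: phi_def)

theorem proposition3p2: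
  fixes M :: "'a measure" and N :: nat
    and z w u v :: "nat \<Rightarrow> nat \<Rightarrow> 'a \<Rightarrow> complex"
    and G T :: "'a \<Rightarrow> complex mat"
    and lam l :: "nat \<Rightarrow> 'a \<Rightarrow> complex"
    and R1 R1' R2 R2' :: "'a \<Rightarrow> complex vec"
    and s :: complex
  assumes "prob_space M" and "N \<ge> 2"
    and s: "s = complex_of_real (sqrt (2 * real N))"
    and ginibre: "iid_std_complex_gaussian M
          (({..<N} \<times> {..<N}) <+> ({..<N} \<times> {..<N})) (joint_family z w)"
    and G: "\<And>\<omega>. G \<omega> = quaternionic_matrix N (\<lambda>i j. z i j \<omega>) (\<lambda>i j. w i j \<omega>)"
    and T: "\<And>\<omega>. T \<omega> = schur_matrix N (\<lambda>i. lam i \<omega>) (\<lambda>i j. u i j \<omega>) (\<lambda>i j. v i j \<omega>)"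
    and schur_form: "AE \<omega> in M. unitarily_equivalent (2 * N) (G \<omega>) (T \<omega>)"
    and lam_law: "has_ginibre_eigenvalue_law M N lam"
    and upper_law: "iid_std_complex_gaussian M
          (upper_pairs N <+> upper_pairs N) (joint_family u v)"
    and upper_indep_lam: "independent_variables M
          (PiM {..<N} (\<lambda>_. borel)) (random_vector {..<N} lam)
          (PiM (upper_pairs N <+> upper_pairs N) (\<lambda>_. borel))
          (random_vector (upper_pairs N <+> upper_pairs N) (joint_family u v))"
    and l: "\<And>i \<omega>. l i \<omega> = lam i \<omega> / s"
    and R1: "AE \<omega> in M. normalized_right_eigenvector ((1 / s) \<cdot>\<^sub>m T \<omega>) (l 0 \<omega>) 0 (R1 \<omega>)"
    and R1': "AE \<omega> in M. normalized_right_eigenvector ((1 / s) \<cdot>\<^sub>m T \<omega>) (cnj (l 0 \<omega>)) 1 (R1' \<omega>)"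
    and R2: "AE \<omega> in M. normalized_right_eigenvector ((1 / s) \<cdot>\<^sub>m T \<omega>) (l 1 \<omega>) 2 (R2 \<omega>)"
    and R2': "AE \<omega> in M. normalized_right_eigenvector ((1 / s) \<cdot>\<^sub>m T \<omega>) (cnj (l 1 \<omega>)) 3 (R2' \<omega>)"
  shows "\<exists>X Y.
      distr M borel X = std_complex_gaussian \<and> distr M borel Y = std_complex_gaussian \<and>
      prob_space.indep_var M borel X borel Y \<and>
      prob_space.indep_var M borel (\<lambda>\<omega>. (X \<omega>, Y \<omega>)) borel (\<lambda>\<omega>. (l 0 \<omega>, l 1 \<omega>)) \<and>
      (AE \<omega> in M. l 0 \<omega> \<in> ball 0 1 \<and> l 1 \<omega> \<in> ball 0 1 \<longrightarrow>
         complex_angle (R1 \<omega>) (R1' \<omega>) = 0 \<and>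
         complex_angle (R2 \<omega>) (R2' \<omega>) = 0 \<and>
         complex_angle (R1 \<omega>) (R2 \<omega>) =
           phi (X \<omega> / (s * (l 0 \<omega> - l 1 \<omega>))) (Y \<omega> / (s * (cnj (l 0 \<omega>) - l 1 \<omega>))) \<and>
         complex_angle (R1' \<omega>) (R2' \<omega>) = cnj (complex_angle (R1 \<omega>) (R2 \<omega>)) \<and>
         complex_angle (R1' \<omega>) (R2 \<omega>) =
           phi (- cnj (Y \<omega>) / (s * (cnj (l 0 \<omega>) - l 1 \<omega>))) (X \<omega> / (s * (l 0 \<omega> - l 1 \<omega>))) \<and>
         complex_angle (R1 \<omega>) (R2' \<omega>) = - cnj (complex_angle (R1' \<omega>) (R2 \<omega>)))"
proof -
  interpret prob_space M by fact
  let ?I = "upper_pairs N <+> upper_pairs N"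
  \<comment> \<open>The signs are forced by the eigenvector equation for \<open>X\<close>, and for \<open>Y\<close> by the angle of
    \<open>cnj \<lambda>\<^sub>1\<close> and \<open>\<lambda>\<^sub>2\<close>, whose numerator \<open>cnj v\<close> has to be \<open>- cnj Y\<close>.\<close>
  let ?X = "\<lambda>\<omega>. - u 0 1 \<omega>" and ?Y = "\<lambda>\<omega>. - v 0 1 \<omega>"
  define \<sigma> where "\<sigma> = sqrt (2 * real N)"
  have \<sigma>: "s = complex_of_real \<sigma>" "\<sigma> \<noteq> 0"
    using s \<open>N \<ge> 2\<close> by (simp_all add: \<sigma>_def)
  have idx: "Inl (0, 1) \<in> ?I" "Inr (0, 1) \<in> ?I"
    using \<open>N \<ge> 2\<close> by (auto simp: upper_pairs_def)
  have fam: "joint_family u v (Inl (0, 1)) = u 0 1" "joint_family u v (Inr (0, 1)) = v 0 1"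
    by (simp_all add: joint_family_def)
  have uv: "indep_vars (\<lambda>_. borel) (joint_family u v) ?I"
    and law: "\<And>i. i \<in> ?I \<Longrightarrow> distr M borel (joint_family u v i) = std_complex_gaussian"
    using upper_law by (auto simp: iid_std_complex_gaussian_def)
  have indep_uv: "indep_var borel (u 0 1) borel (v 0 1)"
    using indep_vars_pair[OF uv idx] unfolding fam by simp
  have gauss: "distr M borel ?X = std_complex_gaussian" "distr M borel ?Y = std_complex_gaussian"
    using distr_uminus_std_complex_gaussian[OF law[OF idx(1), unfolded fam] indep_var_rv1[OF indep_uv]]
      distr_uminus_std_complex_gaussian[OF law[OF idx(2), unfolded fam] indep_var_rv2[OF indep_uv]]
    by simp_all
  have indep_XY: "indep_var borel ?X borel ?Y"
    using indep_var_compose[OF indep_uv, of uminus borel uminus borel] by (simp add: comp_def)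
  have indep_l: "indep_var borel (\<lambda>\<omega>. (?X \<omega>, ?Y \<omega>)) borel (\<lambda>\<omega>. (l 0 \<omega>, l 1 \<omega>))"
  proof -
    let ?f = "\<lambda>x :: nat \<Rightarrow> complex. (x 0 / s, x 1 / s)"
    let ?g = "\<lambda>x :: nat \<times> nat + nat \<times> nat \<Rightarrow> complex. (- x (Inl (0, 1)), - x (Inr (0, 1)))"
    have [measurable]: "(\<lambda>x. x i) \<in> borel_measurable (PiM {..<N} (\<lambda>_. borel :: complex measure))"
      if "i < N" for i
      using that by (intro measurable_component_singleton) simp
    have "?f \<in> borel_measurable (PiM {..<N} (\<lambda>_. borel))"
      using \<open>N \<ge> 2\<close> by (intro borel_measurable_Pair borel_measurable_divide) simp_all
    moreover have "?g \<in> borel_measurable (PiM ?I (\<lambda>_. borel))"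
      using idx by (intro borel_measurable_Pair borel_measurable_uminus
          measurable_component_singleton) simp_all
    ultimately have "indep_var borel
        (\<lambda>\<omega>. ?g (random_vector ?I (joint_family u v) \<omega>)) borel (\<lambda>\<omega>. ?f (random_vector {..<N} lam \<omega>))"
      by (rule independent_variables_compose[OF upper_indep_lam])
    then show ?thesis
      using idx fam \<open>N \<ge> 2\<close> by (simp add: random_vector_def l)
  qed
  have distinct: "AE \<omega> in M. lam 0 \<omega> \<noteq> lam 1 \<omega> \<and> lam 0 \<omega> \<noteq> cnj (lam 1 \<omega>)"
    using ginibre_eigenvalues_distinct[OF lam_law, of 0 1] \<open>N \<ge> 2\<close> by simp
  have angles: "AE \<omega> in M.
         complex_angle (R1 \<omega>) (R1' \<omega>) = 0 \<and>
         complex_angle (R2 \<omega>) (R2' \<omega>) = 0 \<and>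
         complex_angle (R1 \<omega>) (R2 \<omega>) =
           phi (?X \<omega> / (s * (l 0 \<omega> - l 1 \<omega>))) (?Y \<omega> / (s * (cnj (l 0 \<omega>) - l 1 \<omega>))) \<and>
         complex_angle (R1' \<omega>) (R2' \<omega>) = cnj (complex_angle (R1 \<omega>) (R2 \<omega>)) \<and>
         complex_angle (R1' \<omega>) (R2 \<omega>) =
           phi (- cnj (?Y \<omega>) / (s * (cnj (l 0 \<omega>) - l 1 \<omega>))) (?X \<omega> / (s * (l 0 \<omega> - l 1 \<omega>))) \<and>
         complex_angle (R1 \<omega>) (R2' \<omega>) = - cnj (complex_angle (R1' \<omega>) (R2 \<omega>))"
    using R1 R1' R2 R2' distinct
  proof eventually_elim
    case (elim \<omega>)
    let ?T = "(1 / s) \<cdot>\<^sub>m T \<omega>"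
    define p where "p = ?X \<omega> / (s * (l 0 \<omega> - l 1 \<omega>))"
    define q where "q = - cnj (?Y \<omega>) / (s * (cnj (l 0 \<omega>) - l 1 \<omega>))"
    have n: "4 \<le> 2 * N" and carrier: "?T \<in> carrier_mat (2 * N) (2 * N)"
      using \<open>N \<ge> 2\<close> schur_matrix_carrier by (simp_all add: T)
    note second = schur_second_eigenvectors[OF \<open>N \<ge> 2\<close> \<sigma>(2),
        of "\<lambda>i. lam i \<omega>" "\<lambda>i j. u i j \<omega>" "\<lambda>i j. v i j \<omega>", OF elim(5)[THEN conjunct1] elim(5)[THEN conjunct2],
        folded \<sigma>(1) T, folded l]
    have R: "R1 \<omega> = two_block_vec (2 * N) 1 0 0 0" "R1' \<omega> = two_block_vec (2 * N) 0 1 0 0"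
      using normalized_right_eigenvector_two_block(1)[OF carrier n elim(1)]
        normalized_right_eigenvector_two_block(2)[OF carrier n elim(2)] by simp_all
    have R': "R2 \<omega> = two_block_vec (2 * N) p q 1 0"
        "R2' \<omega> = two_block_vec (2 * N) (- cnj q) (cnj p) 0 1"
      using second(1)[OF elim(3)] second(2)[OF elim(4)] by (simp_all add: p_def q_def)
    have "phi p q = phi p (?Y \<omega> / (s * (cnj (l 0 \<omega>) - l 1 \<omega>)))"
      by (rule phi_cong_cmod) (simp add: q_def norm_divide)
    then show ?case
      unfolding R R' p_def[symmetric] q_def[symmetric]
      by (simp only: complex_angles_conjugate_frame[OF n] simp_thms)
  qed
  show ?thesis
    by (intro exI[of _ ?X] exI[of _ ?Y] conjI gauss indep_XY indep_l,
        rule eventually_mono[OF angles], rule impI, assumption)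
qed

end
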